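(* Let $\tilde p:\mathcal{A}\to\mathcal{X}$ be a Fell bundle over a locally compact Hausdorff groupoid, and let $H$ be a locally compact group. Suppose $H$ acts freely and properly by automorphisms on the right of $\mathcal{A}$, and let $p:\mathcal{B}\to\mathcal{Y}$ be the quotient Fell bundle (so that $\mathcal{B}=\mathcal{A}/H$ and $\mathcal{Y}=\mathcal{X}/H$). Then there is an action of $\mathcal{Y}$ on $\mathcal{X}^{(0)}$ such that $\mathcal{A}$ is $H$-equivariantly isomorphic to the transformation Fell bundle $\mathcal{B}*\mathcal{X}^{(0)}$.
   Context: Conventions. All spaces, groups and groupoids are locally compact, Hausdorff and second countable; the given groupoid carries a left Haar system (so $r,s$ are continuous and open). Banach bundles. A (upper semicontinuous) Banach bundle is a continuous open surjection whose fibres are complex Banach spaces, such that the norm is upper semicontinuous on the total space, addition and scalar multiplication are continuous, and any net whose base points converge to $\omega$ and whose norms tend to $0$ converges to $0_\omega$. Bundles are separable: the Banach space of continuous sections vanishing at infinity is separable. Fell bundles. A Fell bundle $p:\mathcal{A}\to\mathcal{X}$ is a separable Banach bundle with a continuous associative multiplication $(a,b)\mapsto ab$ defined when $s(p(a))=r(p(b))$, bilinear on fibres with $p(ab)=p(a)p(b)$, and a continuous conjugate-linear involution with $p(a^* )=p(a)^{-1}$, $(ab)^*=b^*a^*$, $a^{**}=a$, such that each fibre $A(u)$, $u\in\mathcal{X}^{(0)}$, is a $C^*$-algebra and each fibre $A(x)$ is an $A(r(x))$–$A(s(x))$ imprimitivity bimodule under multiplication with inner products $ab^*$ and $a^*b$.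 Write $s(a)=s(p(a))$, $r(a)=r(p(a))$. Group actions. A right action of $H$ on $\mathcal{X}$ by automorphisms is a continuous map $(x,h)\mapsto x\cdot h$ with each $x\mapsto x\cdot h$ a groupoid automorphism and $(x\cdot h)\cdot k=x\cdot(hk)$. A right action of $H$ on $\mathcal{A}$ by automorphisms consists of such an action on $\mathcal{X}$ together with a continuous map $\mathcal{A}\times H\to\mathcal{A}$ with each $a\mapsto a\cdot h$ a Fell bundle automorphism (fibrewise linear isometric, preserving product and involution, covering $x\mapsto x\cdot h$) and $(a\cdot h)\cdot k=a\cdot(hk)$. It is free and proper if the action on the space $\mathcal{X}$ is. Quotients. $\mathcal{X}/H$ is a groupoid with $(x\cdot H)(y\cdot H)=(xy)\cdot H$ when $s(x)=r(y)$; $\mathcal{A}/H\to\mathcal{X}/H$ is a Fell bundle with $p(a\cdot H)=\tilde p(a)\cdot H$, $(a\cdot H)(b\cdot H)=(ab)\cdot H$ if $s(a)=r(b)$, $(a\cdot H)^*=a^*\cdot H$, $\|a\cdot H\|=\|a\|$. Transformation bundles. An action of a groupoid $\mathcal{Y}$ on the left of a space $\Omega$ consists of a continuous open map $\rho:\Omega\to\mathcal{Y}^{(0)}$ and a continuous map $(y,u)\mapsto y\cdot u$ on $\mathcal{Y}*\Omega=\{(y,u):s(y)=\rho(u)\}$ with $\rho(y\cdot u)=r(y)$, $(yz)\cdot u=y\cdot(z\cdot u)$, $\rho(u)\cdot u=u$. The transformation groupoid is $\mathcal{Y}*\Omega$ with $(y,z\cdot u)(z,u)=(yz,u)$ and $(y,u)^{-1}=(y^{-1},y\cdot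 u)$. For a Fell bundle $p:\mathcal{B}\to\mathcal{Y}$ the transformation Fell bundle is $\mathcal{B}*\Omega=\{(b,u):s(b)=\rho(u)\}$ over $\mathcal{Y}*\Omega$, with projection $(b,u)\mapsto(p(b),u)$, product $(a,p(b)\cdot u)(b,u)=(ab,u)$ and involution $(a,u)^*=(a^*,p(a)\cdot u)$. When $H$ acts on the right of $\Omega$, commuting with the $\mathcal{Y}$-action and with $\rho$ constant on $H$-orbits, $H$ acts on $\mathcal{B}*\Omega$ by $(b,u)\cdot h=(b,u\cdot h)$; $H$-equivariance in the claim refers to this action with $\Omega=\mathcal{X}^{(0)}$. Isomorphisms of Fell bundles are homeomorphisms covering groupoid isomorphisms, fibrewise linear isometric and preserving product and involution. *)

theory Defs
  imports "HOL-Analysis.Analysis" "HOL-Algebra.Group"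
begin

section \<open>Banach spaces, C*-algebras and imprimitivity bimodules on carrier sets\<close>

text \<open>The fibres of a bundle are subsets of one type, so the linear structures are given on
  carrier sets rather than by type classes.\<close>

record 'v vec_data =
  vcar :: "'v set"
  vadd :: "'v \<Rightarrow> 'v \<Rightarrow> 'v"
  vscale :: "complex \<Rightarrow> 'v \<Rightarrow> 'v"
  vzero :: 'v
  vnorm :: "'v \<Rightarrow> real"

record 'v alg_data = "'v vec_data" +
  vmult :: "'v \<Rightarrow> 'v \<Rightarrow> 'v"
  vstar :: "'v \<Rightarrow> 'v"

definition vdiff :: "('v, 'm) vec_data_scheme \<Rightarrow> 'v \<Rightarrow> 'v \<Rightarrow> 'v" where
  "vdiff V a b = vadd V a (vscale V (-1) b)"

locale complex_banach_space =
  fixes V :: "('v, 'm) vec_data_scheme" (structure)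
  assumes add_closed: "\<lbrakk>a \<in> vcar V; b \<in> vcar V\<rbrakk> \<Longrightarrow> vadd V a b \<in> vcar V"
    and scale_closed: "a \<in> vcar V \<Longrightarrow> vscale V c a \<in> vcar V"
    and zero_closed: "vzero V \<in> vcar V"
    and add_assoc: "\<lbrakk>a \<in> vcar V; b \<in> vcar V; d \<in> vcar V\<rbrakk>
          \<Longrightarrow> vadd V (vadd V a b) d = vadd V a (vadd V b d)"
    and add_commute: "\<lbrakk>a \<in> vcar V; b \<in> vcar V\<rbrakk> \<Longrightarrow> vadd V a b = vadd V b a"
    and add_zero: "a \<in> vcar V \<Longrightarrow> vadd V a (vzero V) = a"
    and add_inverse: "a \<in> vcar V \<Longrightarrow> \<exists>b\<in>vcar V. vadd V a b = vzero V"
    and scale_add: "\<lbrakk>a \<in> vcar V; b \<in> vcar V\<rbrakk>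
          \<Longrightarrow> vscale V c (vadd V a b) = vadd V (vscale V c a) (vscale V c b)"
    and add_scale: "a \<in> vcar V \<Longrightarrow> vscale V (c + c') a = vadd V (vscale V c a) (vscale V c' a)"
    and scale_scale: "a \<in> vcar V \<Longrightarrow> vscale V c (vscale V c' a) = vscale V (c * c') a"
    and scale_one: "a \<in> vcar V \<Longrightarrow> vscale V 1 a = a"
    and norm_nonneg: "a \<in> vcar V \<Longrightarrow> 0 \<le> vnorm V a"
    and norm_eq_zero: "a \<in> vcar V \<Longrightarrow> vnorm V a = 0 \<longleftrightarrow> a = vzero V"
    and norm_triangle: "\<lbrakk>a \<in> vcar V; b \<in> vcar V\<rbrakk> \<Longrightarrow> vnorm V (vadd V a b) \<le> vnorm V a + vnorm V b"
    and norm_scale: "a \<in> vcar V \<Longrightarrow> vnorm V (vscale V c a) = cmod c * vnorm V a"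
    and complete:
      "\<lbrakk>\<And>n. \<sigma> n \<in> vcar V;
        \<And>e. e > 0 \<Longrightarrow> \<exists>N. \<forall>m\<ge>N. \<forall>n\<ge>N. vnorm V (vdiff V (\<sigma> m) (\<sigma> n)) < e\<rbrakk>
       \<Longrightarrow> \<exists>l\<in>vcar V. (\<lambda>n::nat. vnorm V (vdiff V (\<sigma> n) l)) \<longlonglongrightarrow> 0"

inductive_set lin_span :: "('v, 'm) vec_data_scheme \<Rightarrow> 'v set \<Rightarrow> 'v set"
  for V :: "('v, 'm) vec_data_scheme" and S :: "'v set" where
  span_base: "a \<in> S \<Longrightarrow> a \<in> lin_span V S"
| span_zero: "vzero V \<in> lin_span V S"
| span_add: "\<lbrakk>a \<in> lin_span V S; b \<in> lin_span V S\<rbrakk> \<Longrightarrow> vadd V a b \<in> lin_span V S"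
| span_scale: "a \<in> lin_span V S \<Longrightarrow> vscale V c a \<in> lin_span V S"

definition dense_span :: "('v, 'm) vec_data_scheme \<Rightarrow> 'v set \<Rightarrow> bool" where
  "dense_span V S \<longleftrightarrow>
     S \<subseteq> vcar V \<and> (\<forall>a\<in>vcar V. \<forall>e>0. \<exists>b\<in>lin_span V S. vnorm V (vdiff V a b) < e)"

locale cstar_algebra = complex_banach_space A
  for A :: "('a, 'm) alg_data_scheme" (structure) +
  assumes mult_closed: "\<lbrakk>a \<in> vcar A; b \<in> vcar A\<rbrakk> \<Longrightarrow> vmult A a b \<in> vcar A"
    and star_closed: "a \<in> vcar A \<Longrightarrow> vstar A a \<in> vcar A"
    and mult_assoc: "\<lbrakk>a \<in> vcar A; b \<in> vcar A; d \<in> vcar A\<rbrakk>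
          \<Longrightarrow> vmult A (vmult A a b) d = vmult A a (vmult A b d)"
    and mult_add_left: "\<lbrakk>a \<in> vcar A; b \<in> vcar A; d \<in> vcar A\<rbrakk>
          \<Longrightarrow> vmult A (vadd A a b) d = vadd A (vmult A a d) (vmult A b d)"
    and mult_add_right: "\<lbrakk>a \<in> vcar A; b \<in> vcar A; d \<in> vcar A\<rbrakk>
          \<Longrightarrow> vmult A a (vadd A b d) = vadd A (vmult A a b) (vmult A a d)"
    and mult_scale_left: "\<lbrakk>a \<in> vcar A; b \<in> vcar A\<rbrakk>
          \<Longrightarrow> vmult A (vscale A c a) b = vscale A c (vmult A a b)"
    and mult_scale_right: "\<lbrakk>a \<in> vcar A; b \<in> vcar A\<rbrakk>
          \<Longrightarrow> vmult A a (vscale A c b) = vscale A c (vmult A a b)"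
    and norm_mult: "\<lbrakk>a \<in> vcar A; b \<in> vcar A\<rbrakk> \<Longrightarrow> vnorm A (vmult A a b) \<le> vnorm A a * vnorm A b"
    and star_add: "\<lbrakk>a \<in> vcar A; b \<in> vcar A\<rbrakk> \<Longrightarrow> vstar A (vadd A a b) = vadd A (vstar A a) (vstar A b)"
    and star_scale: "a \<in> vcar A \<Longrightarrow> vstar A (vscale A c a) = vscale A (cnj c) (vstar A a)"
    and star_star: "a \<in> vcar A \<Longrightarrow> vstar A (vstar A a) = a"
    and star_mult: "\<lbrakk>a \<in> vcar A; b \<in> vcar A\<rbrakk> \<Longrightarrow> vstar A (vmult A a b) = vmult A (vstar A b) (vstar A a)"
    and cstar_identity: "a \<in> vcar A \<Longrightarrow> vnorm A (vmult A (vstar A a) a) = (vnorm A a)\<^sup>2"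

definition cstar_positive :: "('a, 'm) alg_data_scheme \<Rightarrow> 'a set" where
  "cstar_positive A = {vmult A (vstar A c) c | c. c \<in> vcar A}"

text \<open>In both module locales the Banach norm of \<open>E\<close> is required to be the inner product norm;
  definiteness of the inner product and completeness for its norm are then those of the Banach
  space \<open>E\<close>.\<close>

locale right_hilbert_module = B: cstar_algebra B + E: complex_banach_space E
  for B :: "('b, 'm) alg_data_scheme" and E :: "('e, 'n) vec_data_scheme" +
  fixes ract :: "'e \<Rightarrow> 'b \<Rightarrow> 'e" and rip :: "'e \<Rightarrow> 'e \<Rightarrow> 'b"
  assumes ract_closed: "\<lbrakk>x \<in> vcar E; b \<in> vcar B\<rbrakk> \<Longrightarrow> ract x b \<in> vcar E"
    and ract_add_left: "\<lbrakk>x \<in> vcar E; y \<in> vcar E; b \<in> vcar B\<rbrakk>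
          \<Longrightarrow> ract (vadd E x y) b = vadd E (ract x b) (ract y b)"
    and ract_add_right: "\<lbrakk>x \<in> vcar E; b \<in> vcar B; b' \<in> vcar B\<rbrakk>
          \<Longrightarrow> ract x (vadd B b b') = vadd E (ract x b) (ract x b')"
    and ract_scale_left: "\<lbrakk>x \<in> vcar E; b \<in> vcar B\<rbrakk> \<Longrightarrow> ract (vscale E c x) b = vscale E c (ract x b)"
    and ract_scale_right: "\<lbrakk>x \<in> vcar E; b \<in> vcar B\<rbrakk> \<Longrightarrow> ract x (vscale B c b) = vscale E c (ract x b)"
    and ract_mult: "\<lbrakk>x \<in> vcar E; b \<in> vcar B; b' \<in> vcar B\<rbrakk>
          \<Longrightarrow> ract x (vmult B b b') = ract (ract x b) b'"
    and rip_closed: "\<lbrakk>x \<in> vcar E; y \<in> vcar E\<rbrakk> \<Longrightarrow> rip x y \<in> vcar B"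
    and rip_add: "\<lbrakk>x \<in> vcar E; y \<in> vcar E; z \<in> vcar E\<rbrakk>
          \<Longrightarrow> rip x (vadd E y z) = vadd B (rip x y) (rip x z)"
    and rip_scale: "\<lbrakk>x \<in> vcar E; y \<in> vcar E\<rbrakk> \<Longrightarrow> rip x (vscale E c y) = vscale B c (rip x y)"
    and rip_ract: "\<lbrakk>x \<in> vcar E; y \<in> vcar E; b \<in> vcar B\<rbrakk> \<Longrightarrow> rip x (ract y b) = vmult B (rip x y) b"
    and rip_star: "\<lbrakk>x \<in> vcar E; y \<in> vcar E\<rbrakk> \<Longrightarrow> vstar B (rip x y) = rip y x"
    and rip_positive: "x \<in> vcar E \<Longrightarrow> rip x x \<in> cstar_positive B"
    and rip_norm: "x \<in> vcar E \<Longrightarrow> (vnorm E x)\<^sup>2 = vnorm B (rip x x)"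

locale left_hilbert_module = A: cstar_algebra A + E: complex_banach_space E
  for A :: "('a, 'm) alg_data_scheme" and E :: "('e, 'n) vec_data_scheme" +
  fixes lact :: "'a \<Rightarrow> 'e \<Rightarrow> 'e" and lip :: "'e \<Rightarrow> 'e \<Rightarrow> 'a"
  assumes lact_closed: "\<lbrakk>x \<in> vcar E; a \<in> vcar A\<rbrakk> \<Longrightarrow> lact a x \<in> vcar E"
    and lact_add_right: "\<lbrakk>x \<in> vcar E; y \<in> vcar E; a \<in> vcar A\<rbrakk>
          \<Longrightarrow> lact a (vadd E x y) = vadd E (lact a x) (lact a y)"
    and lact_add_left: "\<lbrakk>x \<in> vcar E; a \<in> vcar A; a' \<in> vcar A\<rbrakk>
          \<Longrightarrow> lact (vadd A a a') x = vadd E (lact a x) (lact a' x)"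
    and lact_scale_right: "\<lbrakk>x \<in> vcar E; a \<in> vcar A\<rbrakk> \<Longrightarrow> lact a (vscale E c x) = vscale E c (lact a x)"
    and lact_scale_left: "\<lbrakk>x \<in> vcar E; a \<in> vcar A\<rbrakk> \<Longrightarrow> lact (vscale A c a) x = vscale E c (lact a x)"
    and lact_mult: "\<lbrakk>x \<in> vcar E; a \<in> vcar A; a' \<in> vcar A\<rbrakk>
          \<Longrightarrow> lact (vmult A a a') x = lact a (lact a' x)"
    and lip_closed: "\<lbrakk>x \<in> vcar E; y \<in> vcar E\<rbrakk> \<Longrightarrow> lip x y \<in> vcar A"
    and lip_add: "\<lbrakk>x \<in> vcar E; y \<in> vcar E; z \<in> vcar E\<rbrakk>
          \<Longrightarrow> lip (vadd E x y) z = vadd A (lip x z) (lip y z)"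
    and lip_scale: "\<lbrakk>x \<in> vcar E; y \<in> vcar E\<rbrakk> \<Longrightarrow> lip (vscale E c x) y = vscale A c (lip x y)"
    and lip_lact: "\<lbrakk>x \<in> vcar E; y \<in> vcar E; a \<in> vcar A\<rbrakk> \<Longrightarrow> lip (lact a x) y = vmult A a (lip x y)"
    and lip_star: "\<lbrakk>x \<in> vcar E; y \<in> vcar E\<rbrakk> \<Longrightarrow> vstar A (lip x y) = lip y x"
    and lip_positive: "x \<in> vcar E \<Longrightarrow> lip x x \<in> cstar_positive A"
    and lip_norm: "x \<in> vcar E \<Longrightarrow> (vnorm E x)\<^sup>2 = vnorm A (lip x x)"

locale imprimitivity_bimodule =
  left_hilbert_module A E lact lip + right_hilbert_module B E ract rip
  for A :: "('a, 'm) alg_data_scheme" and B :: "('b, 'n) alg_data_scheme"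
    and E :: "('e, 'k) vec_data_scheme" and lact ract lip rip +
  assumes left_full: "dense_span A {lip x y | x y. x \<in> vcar E \<and> y \<in> vcar E}"
    and right_full: "dense_span B {rip x y | x y. x \<in> vcar E \<and> y \<in> vcar E}"
    and act_assoc: "\<lbrakk>a \<in> vcar A; x \<in> vcar E; b \<in> vcar B\<rbrakk> \<Longrightarrow> ract (lact a x) b = lact a (ract x b)"
    and rip_adjoint: "\<lbrakk>a \<in> vcar A; x \<in> vcar E; y \<in> vcar E\<rbrakk>
          \<Longrightarrow> rip (lact a x) y = rip x (lact (vstar A a) y)"
    and lip_adjoint: "\<lbrakk>b \<in> vcar B; x \<in> vcar E; y \<in> vcar E\<rbrakk>
          \<Longrightarrow> lip (ract x b) y = lip x (ract y (vstar B b))"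
    and imprimitivity: "\<lbrakk>x \<in> vcar E; y \<in> vcar E; z \<in> vcar E\<rbrakk> \<Longrightarrow> lact (lip x y) z = ract x (rip y z)"


section \<open>Locally compact groupoids and Haar systems\<close>

text \<open>\<open>gmult G x y\<close> is meaningful only if \<open>src G x = rng G y\<close>.  The unit space is identified
  with the set of identity arrows.\<close>

record 'x groupoid_data =
  gtop :: "'x topology"
  rng :: "'x \<Rightarrow> 'x"
  src :: "'x \<Rightarrow> 'x"
  gmult :: "'x \<Rightarrow> 'x \<Rightarrow> 'x"
  ginv :: "'x \<Rightarrow> 'x"

abbreviation arrows :: "('x, 'm) groupoid_data_scheme \<Rightarrow> 'x set" where
  "arrows G \<equiv> topspace (gtop G)"

definition gunits :: "('x, 'm) groupoid_data_scheme \<Rightarrow> 'x set" where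
  "gunits G = rng G ` arrows G"

definition unit_space :: "('x, 'm) groupoid_data_scheme \<Rightarrow> 'x topology" where
  "unit_space G = subtopology (gtop G) (gunits G)"

definition composable :: "('x, 'm) groupoid_data_scheme \<Rightarrow> ('x \<times> 'x) set" where
  "composable G = {(x, y). x \<in> arrows G \<and> y \<in> arrows G \<and> src G x = rng G y}"

definition lch2_space :: "'x topology \<Rightarrow> bool" where
  "lch2_space T \<longleftrightarrow> locally_compact_space T \<and> Hausdorff_space T \<and> second_countable T"

locale lc_groupoid =
  fixes G :: "('x, 'm) groupoid_data_scheme" (structure)
  assumes space: "lch2_space (gtop G)"
    and rng_closed: "x \<in> arrows G \<Longrightarrow> rng G x \<in> arrows G"
    and src_closed: "x \<in> arrows G \<Longrightarrow> src G x \<in> arrows G"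
    and rng_rng: "x \<in> arrows G \<Longrightarrow> rng G (rng G x) = rng G x"
    and src_rng: "x \<in> arrows G \<Longrightarrow> src G (rng G x) = rng G x"
    and rng_src: "x \<in> arrows G \<Longrightarrow> rng G (src G x) = src G x"
    and src_src: "x \<in> arrows G \<Longrightarrow> src G (src G x) = src G x"
    and mult_closed: "(x, y) \<in> composable G \<Longrightarrow> gmult G x y \<in> arrows G"
    and rng_mult: "(x, y) \<in> composable G \<Longrightarrow> rng G (gmult G x y) = rng G x"
    and src_mult: "(x, y) \<in> composable G \<Longrightarrow> src G (gmult G x y) = src G y"
    and mult_assoc: "\<lbrakk>(x, y) \<in> composable G; (y, z) \<in> composable G\<rbrakk>
          \<Longrightarrow> gmult G (gmult G x y) z = gmult G x (gmult G y z)"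
    and rng_unit: "x \<in> arrows G \<Longrightarrow> gmult G (rng G x) x = x"
    and src_unit: "x \<in> arrows G \<Longrightarrow> gmult G x (src G x) = x"
    and inv_closed: "x \<in> arrows G \<Longrightarrow> ginv G x \<in> arrows G"
    and rng_inv: "x \<in> arrows G \<Longrightarrow> rng G (ginv G x) = src G x"
    and src_inv: "x \<in> arrows G \<Longrightarrow> src G (ginv G x) = rng G x"
    and mult_inv: "x \<in> arrows G \<Longrightarrow> gmult G x (ginv G x) = rng G x"
    and inv_mult: "x \<in> arrows G \<Longrightarrow> gmult G (ginv G x) x = src G x"
    and continuous_mult:
      "continuous_map (subtopology (prod_topology (gtop G) (gtop G)) (composable G)) (gtop G)
         (\<lambda>(x, y). gmult G x y)"
    and continuous_inv: "continuous_map (gtop G) (gtop G) (ginv G)"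

definition cont_compact_support :: "'x topology \<Rightarrow> ('x \<Rightarrow> complex) set" where
  "cont_compact_support T =
     {f. continuous_map T euclidean f \<and> (\<exists>K. compactin T K \<and> (\<forall>x\<in>topspace T - K. f x = 0))}"

definition measure_support :: "'x topology \<Rightarrow> 'x measure \<Rightarrow> 'x set" where
  "measure_support T \<mu> = {x \<in> topspace T. \<forall>U. openin T U \<and> x \<in> U \<longrightarrow> emeasure \<mu> U > 0}"

text \<open>On a second countable locally compact Hausdorff space the Radon measures are the Borel measures
  finite on compact sets.  The set integral in the invariance axiom discards the
  values of \<open>gmult\<close> at pairs that are not composable.\<close>

locale left_haar_system = lc_groupoid G
  for G :: "('x, 'm) groupoid_data_scheme" (structure) +
  fixes haar :: "'x \<Rightarrow> 'x measure"
  assumes haar_sets: "u \<in> gunits G \<Longrightarrow> sets (haar u) = sets (sigma (arrows G) {U. openin (gtop G) U})"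
    and haar_finite: "\<lbrakk>u \<in> gunits G; compactin (gtop G) K\<rbrakk> \<Longrightarrow> emeasure (haar u) K < \<infinity>"
    and haar_support: "u \<in> gunits G \<Longrightarrow>
          measure_support (gtop G) (haar u) = {x \<in> arrows G. rng G x = u}"
    and haar_continuous: "f \<in> cont_compact_support (gtop G) \<Longrightarrow>
          continuous_map (unit_space G) euclidean (\<lambda>u. LINT x|haar u. f x)"
    and haar_invariant: "\<lbrakk>f \<in> cont_compact_support (gtop G); x \<in> arrows G\<rbrakk> \<Longrightarrow>
          (LINT y:{y \<in> arrows G. rng G y = src G x}|haar (src G x). f (gmult G x y))
            = (LINT y|haar (rng G x). f y)"

definition groupoid_iso ::
  "('x, 'm) groupoid_data_scheme \<Rightarrow> ('y, 'n) groupoid_data_scheme \<Rightarrow> ('x \<Rightarrow> 'y) \<Rightarrow> bool" where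
  "groupoid_iso G K \<phi> \<longleftrightarrow>
     homeomorphic_map (gtop G) (gtop K) \<phi> \<and>
     (\<forall>x\<in>arrows G. rng K (\<phi> x) = \<phi> (rng G x) \<and> src K (\<phi> x) = \<phi> (src G x)) \<and>
     (\<forall>(x, y)\<in>composable G. \<phi> (gmult G x y) = gmult K (\<phi> x) (\<phi> y))"


section \<open>Banach bundles and Fell bundles\<close>

record ('a, 'x) bundle_data =
  btop :: "'a topology"
  proj :: "'a \<Rightarrow> 'x"
  badd :: "'a \<Rightarrow> 'a \<Rightarrow> 'a"
  bscale :: "complex \<Rightarrow> 'a \<Rightarrow> 'a"
  bzero :: "'x \<Rightarrow> 'a"
  bnorm :: "'a \<Rightarrow> real"

record ('a, 'x) fell_data = "('a, 'x) bundle_data" +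
  bmult :: "'a \<Rightarrow> 'a \<Rightarrow> 'a"
  bstar :: "'a \<Rightarrow> 'a"

abbreviation total :: "('a, 'x, 'm) bundle_data_scheme \<Rightarrow> 'a set" where
  "total A \<equiv> topspace (btop A)"

definition fibre :: "('a, 'x, 'm) bundle_data_scheme \<Rightarrow> 'x \<Rightarrow> 'a vec_data" where
  "fibre A x = \<lparr>vcar = {a \<in> total A. proj A a = x}, vadd = badd A, vscale = bscale A,
     vzero = bzero A x, vnorm = bnorm A\<rparr>"

definition fibre_alg :: "('a, 'x, 'm) fell_data_scheme \<Rightarrow> 'x \<Rightarrow> 'a alg_data" where
  "fibre_alg A x = \<lparr>vcar = {a \<in> total A. proj A a = x}, vadd = badd A, vscale = bscale A,
     vzero = bzero A x, vnorm = bnorm A, vmult = bmult A, vstar = bstar A\<rparr>"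

definition same_fibre :: "('a, 'x, 'm) bundle_data_scheme \<Rightarrow> ('a \<times> 'a) set" where
  "same_fibre A = {(a, b). a \<in> total A \<and> b \<in> total A \<and> proj A a = proj A b}"

definition bcomposable ::
  "('x, 'm) groupoid_data_scheme \<Rightarrow> ('a, 'x, 'n) bundle_data_scheme \<Rightarrow> ('a \<times> 'a) set" where
  "bcomposable X A = {(a, b). a \<in> total A \<and> b \<in> total A \<and> src X (proj A a) = rng X (proj A b)}"

definition sections_vanishing ::
  "'x topology \<Rightarrow> ('a, 'x, 'm) bundle_data_scheme \<Rightarrow> ('x \<Rightarrow> 'a) set" where
  "sections_vanishing T A =
     {f. continuous_map T (btop A) f \<and> (\<forall>x\<in>topspace T. proj A (f x) = x) \<and>
         (\<forall>e>0. \<exists>K. compactin T K \<and> (\<forall>x\<in>topspace T - K. bnorm A (f x) < e))}"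

text \<open>Nets in the total space are represented by filters on it.  In the separability axiom, a
  countable set of sections is dense for the supremum norm.\<close>

locale separable_banach_bundle =
  fixes T :: "'x topology" and A :: "('a, 'x, 'm) bundle_data_scheme"
  assumes proj_continuous: "continuous_map (btop A) T (proj A)"
    and proj_open: "open_map (btop A) T (proj A)"
    and proj_surj: "proj A ` total A = topspace T"
    and fibre_banach: "x \<in> topspace T \<Longrightarrow> complex_banach_space (fibre A x)"
    and norm_usc: "openin (btop A) {a \<in> total A. bnorm A a < e}"
    and add_continuous:
      "continuous_map (subtopology (prod_topology (btop A) (btop A)) (same_fibre A)) (btop A)
         (\<lambda>(a, b). badd A a b)"
    and scale_continuous:
      "continuous_map (prod_topology euclidean (btop A)) (btop A) (\<lambda>(c, a). bscale A c a)"
    and null_net: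
      "\<lbrakk>eventually (\<lambda>a. a \<in> total A) F; limitin T (proj A) \<omega> F; (bnorm A \<longlongrightarrow> 0) F\<rbrakk>
       \<Longrightarrow> limitin (btop A) (\<lambda>a. a) (bzero A \<omega>) F"
    and separable:
      "\<exists>D. countable D \<and> D \<subseteq> sections_vanishing T A \<and>
           (\<forall>f\<in>sections_vanishing T A. \<forall>e>0. \<exists>g\<in>D.
              \<forall>x\<in>topspace T. bnorm A (vdiff (fibre A x) (f x) (g x)) \<le> e)"

locale fell_bundle = X: lc_groupoid X + separable_banach_bundle "gtop X" A
  for X :: "('x, 'm) groupoid_data_scheme" and A :: "('a, 'x, 'n) fell_data_scheme" +
  assumes bmult_continuous:
      "continuous_map (subtopology (prod_topology (btop A) (btop A)) (bcomposable X A)) (btop A)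
         (\<lambda>(a, b). bmult A a b)"
    and proj_bmult: "(a, b) \<in> bcomposable X A \<Longrightarrow>
          proj A (bmult A a b) = gmult X (proj A a) (proj A b)"
    and bmult_assoc: "\<lbrakk>(a, b) \<in> bcomposable X A; (b, c) \<in> bcomposable X A\<rbrakk> \<Longrightarrow>
          bmult A (bmult A a b) c = bmult A a (bmult A b c)"
    and bmult_add_left: "\<lbrakk>(a, a') \<in> same_fibre A; (a, b) \<in> bcomposable X A\<rbrakk> \<Longrightarrow>
          bmult A (badd A a a') b = badd A (bmult A a b) (bmult A a' b)"
    and bmult_add_right: "\<lbrakk>(b, b') \<in> same_fibre A; (a, b) \<in> bcomposable X A\<rbrakk> \<Longrightarrow>
          bmult A a (badd A b b') = badd A (bmult A a b) (bmult A a b')"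
    and bmult_scale_left: "(a, b) \<in> bcomposable X A \<Longrightarrow>
          bmult A (bscale A z a) b = bscale A z (bmult A a b)"
    and bmult_scale_right: "(a, b) \<in> bcomposable X A \<Longrightarrow>
          bmult A a (bscale A z b) = bscale A z (bmult A a b)"
    and bstar_continuous: "continuous_map (btop A) (btop A) (bstar A)"
    and proj_bstar: "a \<in> total A \<Longrightarrow> proj A (bstar A a) = ginv X (proj A a)"
    and bstar_add: "(a, b) \<in> same_fibre A \<Longrightarrow>
          bstar A (badd A a b) = badd A (bstar A a) (bstar A b)"
    and bstar_scale: "a \<in> total A \<Longrightarrow> bstar A (bscale A z a) = bscale A (cnj z) (bstar A a)"
    and bstar_bmult: "(a, b) \<in> bcomposable X A \<Longrightarrow>
          bstar A (bmult A a b) = bmult A (bstar A b) (bstar A a)"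
    and bstar_bstar: "a \<in> total A \<Longrightarrow> bstar A (bstar A a) = a"
    and unit_fibre_cstar: "u \<in> gunits X \<Longrightarrow> cstar_algebra (fibre_alg A u)"
    and fibre_imprimitivity: "x \<in> arrows X \<Longrightarrow>
          imprimitivity_bimodule (fibre_alg A (rng X x)) (fibre_alg A (src X x)) (fibre A x)
            (bmult A) (bmult A) (\<lambda>a b. bmult A a (bstar A b)) (\<lambda>a b. bmult A (bstar A a) b)"

definition fell_iso ::
  "('x, 'm) groupoid_data_scheme \<Rightarrow> ('a, 'x, 'k) fell_data_scheme \<Rightarrow>
   ('y, 'n) groupoid_data_scheme \<Rightarrow> ('b, 'y, 'l) fell_data_scheme \<Rightarrow>
   ('x \<Rightarrow> 'y) \<Rightarrow> ('a \<Rightarrow> 'b) \<Rightarrow> bool" where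
  "fell_iso X A Y B \<phi> \<Phi> \<longleftrightarrow>
     groupoid_iso X Y \<phi> \<and>
     homeomorphic_map (btop A) (btop B) \<Phi> \<and>
     (\<forall>a\<in>total A. proj B (\<Phi> a) = \<phi> (proj A a)) \<and>
     (\<forall>(a, b)\<in>same_fibre A. \<Phi> (badd A a b) = badd B (\<Phi> a) (\<Phi> b)) \<and>
     (\<forall>c. \<forall>a\<in>total A. \<Phi> (bscale A c a) = bscale B c (\<Phi> a)) \<and>
     (\<forall>a\<in>total A. bnorm B (\<Phi> a) = bnorm A a) \<and>
     (\<forall>(a, b)\<in>bcomposable X A. \<Phi> (bmult A a b) = bmult B (\<Phi> a) (\<Phi> b)) \<and>
     (\<forall>a\<in>total A. \<Phi> (bstar A a) = bstar B (\<Phi> a))"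


section \<open>Actions of groups\<close>

locale lc_group = group H
  for H :: "('h, 'm) monoid_scheme" (structure) and TH :: "'h topology" +
  assumes group_space: "lch2_space TH"
    and topspace_group: "topspace TH = carrier H"
    and group_mult_continuous: "continuous_map (prod_topology TH TH) TH (\<lambda>(h, k). h \<otimes> k)"
    and group_inv_continuous: "continuous_map TH TH (\<lambda>h. inv h)"

text \<open>The identity of \<open>H\<close> acts trivially because it acts by an injective map.\<close>

locale groupoid_group_action = X: lc_groupoid X + H: lc_group H TH
  for X :: "('x, 'm) groupoid_data_scheme" and H :: "('h, 'k) monoid_scheme"
    and TH :: "'h topology" +
  fixes actX :: "'x \<Rightarrow> 'h \<Rightarrow> 'x"
  assumes actX_continuous: "continuous_map (prod_topology (gtop X) TH) (gtop X) (\<lambda>(x, h). actX x h)"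
    and actX_iso: "h \<in> carrier H \<Longrightarrow> groupoid_iso X X (\<lambda>x. actX x h)"
    and actX_actX: "\<lbrakk>x \<in> arrows X; h \<in> carrier H; k \<in> carrier H\<rbrakk> \<Longrightarrow>
          actX (actX x h) k = actX x (h \<otimes>\<^bsub>H\<^esub> k)"

locale fell_group_action = fell_bundle X A + groupoid_group_action X H TH actX
  for X :: "('x, 'm) groupoid_data_scheme" and A :: "('a, 'x, 'n) fell_data_scheme"
    and H :: "('h, 'k) monoid_scheme" and TH :: "'h topology" and actX :: "'x \<Rightarrow> 'h \<Rightarrow> 'x" +
  fixes actA :: "'a \<Rightarrow> 'h \<Rightarrow> 'a"
  assumes actA_continuous: "continuous_map (prod_topology (btop A) TH) (btop A) (\<lambda>(a, h). actA a h)"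
    and actA_iso: "h \<in> carrier H \<Longrightarrow> fell_iso X A X A (\<lambda>x. actX x h) (\<lambda>a. actA a h)"
    and actA_actA: "\<lbrakk>a \<in> total A; h \<in> carrier H; k \<in> carrier H\<rbrakk> \<Longrightarrow>
          actA (actA a h) k = actA a (h \<otimes>\<^bsub>H\<^esub> k)"

definition free_action :: "('h, 'k) monoid_scheme \<Rightarrow> 'x topology \<Rightarrow> ('x \<Rightarrow> 'h \<Rightarrow> 'x) \<Rightarrow> bool" where
  "free_action H T act \<longleftrightarrow> (\<forall>x\<in>topspace T. \<forall>h\<in>carrier H. act x h = x \<longrightarrow> h = \<one>\<^bsub>H\<^esub>)"

definition proper_action :: "'h topology \<Rightarrow> 'x topology \<Rightarrow> ('x \<Rightarrow> 'h \<Rightarrow> 'x) \<Rightarrow> bool" where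
  "proper_action TH T act \<longleftrightarrow>
     proper_map (prod_topology T TH) (prod_topology T T) (\<lambda>(x, h). (x, act x h))"


section \<open>Quotients\<close>

definition quotient_topology :: "'x topology \<Rightarrow> ('x \<Rightarrow> 'y) \<Rightarrow> 'y topology" where
  "quotient_topology T q =
     topology (\<lambda>U. U \<subseteq> q ` topspace T \<and> openin T {x \<in> topspace T. q x \<in> U})"

lemma openin_quotient_topology:
  "openin (quotient_topology T q) U \<longleftrightarrow>
     U \<subseteq> q ` topspace T \<and> openin T {x \<in> topspace T. q x \<in> U}"
proof -
  have "istopology (\<lambda>U. U \<subseteq> q ` topspace T \<and> openin T {x \<in> topspace T. q x \<in> U})"
    unfolding istopology_def
  proof (intro conjI allI impI)
    fix S U
    assume SU: "S \<subseteq> q ` topspace T \<and> openin T {x \<in> topspace T. q x \<in> S}"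
      "U \<subseteq> q ` topspace T \<and> openin T {x \<in> topspace T. q x \<in> U}"
    then show "S \<inter> U \<subseteq> q ` topspace T" by blast
    have "{x \<in> topspace T. q x \<in> S \<inter> U}
        = {x \<in> topspace T. q x \<in> S} \<inter> {x \<in> topspace T. q x \<in> U}" by auto
    then show "openin T {x \<in> topspace T. q x \<in> S \<inter> U}" using SU by (simp only: openin_Int)
  next
    fix K
    assume *: "\<forall>S\<in>K. S \<subseteq> q ` topspace T \<and> openin T {x \<in> topspace T. q x \<in> S}"
    then show "\<Union>K \<subseteq> q ` topspace T" by blast
    have "{x \<in> topspace T. q x \<in> \<Union>K} = (\<Union>S\<in>K. {x \<in> topspace T. q x \<in> S})" by blast
    moreover have "openin T (\<Union>S\<in>K. {x \<in> topspace T. q x \<in> S})"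
      using * by (intro openin_Union) blast
    ultimately show "openin T {x \<in> topspace T. q x \<in> \<Union>K}" by simp
  qed
  then show ?thesis
    unfolding quotient_topology_def by (simp only: topology_inverse')
qed

lemma topspace_quotient_topology: "topspace (quotient_topology T q) = q ` topspace T"
proof
  have "openin (quotient_topology T q) (topspace (quotient_topology T q))" by (rule openin_topspace)
  then show "topspace (quotient_topology T q) \<subseteq> q ` topspace T"
    by (rule openin_quotient_topology [THEN iffD1, THEN conjunct1])
  have "{x \<in> topspace T. q x \<in> q ` topspace T} = topspace T" by blast
  then have "openin (quotient_topology T q) (q ` topspace T)"
    by (simp only: openin_quotient_topology openin_topspace subset_refl simp_thms)
  then show "q ` topspace T \<subseteq> topspace (quotient_topology T q)"
    by (rule openin_subset)
qed

lemma quotient_map_quotient_topology: "quotient_map T (quotient_topology T q) q"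
  by (simp add: quotient_map_def topspace_quotient_topology openin_quotient_topology)

definition orbit :: "('h, 'k) monoid_scheme \<Rightarrow> ('x \<Rightarrow> 'h \<Rightarrow> 'x) \<Rightarrow> 'x \<Rightarrow> 'x set" where
  "orbit H act x = act x ` carrier H"

text \<open>The operations on orbits collect the values on all admissible representatives.  For a free
  action by automorphisms the result is a single orbit; see the lemmas at the end of
  this section.\<close>

definition quotient_groupoid ::
  "('x, 'm) groupoid_data_scheme \<Rightarrow> ('h, 'k) monoid_scheme \<Rightarrow> ('x \<Rightarrow> 'h \<Rightarrow> 'x) \<Rightarrow> 'x set groupoid_data"
  where
  "quotient_groupoid X H act = \<lparr>
     gtop = quotient_topology (gtop X) (orbit H act),
     rng = (\<lambda>S. rng X ` S),
     src = (\<lambda>S. src X ` S),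
     gmult = (\<lambda>S T. {gmult X x y | x y. x \<in> S \<and> y \<in> T \<and> src X x = rng X y}),
     ginv = (\<lambda>S. ginv X ` S)\<rparr>"

definition quotient_fell ::
  "('x, 'm) groupoid_data_scheme \<Rightarrow> ('a, 'x, 'n) fell_data_scheme \<Rightarrow> ('h, 'k) monoid_scheme \<Rightarrow>
   ('a \<Rightarrow> 'h \<Rightarrow> 'a) \<Rightarrow> ('a set, 'x set) fell_data" where
  "quotient_fell X A H act = \<lparr>
     btop = quotient_topology (btop A) (orbit H act),
     proj = (\<lambda>S. proj A ` S),
     badd = (\<lambda>S T. {badd A a b | a b. a \<in> S \<and> b \<in> T \<and> proj A a = proj A b}),
     bscale = (\<lambda>c S. bscale A c ` S),
     bzero = (\<lambda>S. bzero A ` S),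
     bnorm = (\<lambda>S. the_elem (bnorm A ` S)),
     bmult = (\<lambda>S T. {bmult A a b | a b. a \<in> S \<and> b \<in> T \<and> src X (proj A a) = rng X (proj A b)}),
     bstar = (\<lambda>S. bstar A ` S)\<rparr>"

lemma (in groupoid_group_action) actX_closed:
  assumes "x \<in> arrows X" "h \<in> carrier H" shows "actX x h \<in> arrows X"
  using actX_iso[OF assms(2)] assms(1) unfolding groupoid_iso_def homeomorphic_map_def
    quotient_map_def by blast

lemma (in groupoid_group_action) actX_one:
  assumes x: "x \<in> arrows X" shows "actX x \<one>\<^bsub>H\<^esub> = x"
proof -
  have "inj_on (\<lambda>x. actX x \<one>\<^bsub>H\<^esub>) (arrows X)"
    using actX_iso[OF H.one_closed] by (simp add: groupoid_iso_def homeomorphic_map_def)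
  moreover have "actX (actX x \<one>\<^bsub>H\<^esub>) \<one>\<^bsub>H\<^esub> = actX x \<one>\<^bsub>H\<^esub>"
    using actX_actX[OF x H.one_closed H.one_closed] by simp
  ultimately show ?thesis
    using actX_closed[OF x H.one_closed] x by (meson inj_onD)
qed

lemma (in groupoid_group_action) actX_hom:
  assumes "h \<in> carrier H"
  shows "x \<in> arrows X \<Longrightarrow> rng X (actX x h) = actX (rng X x) h"
    and "x \<in> arrows X \<Longrightarrow> src X (actX x h) = actX (src X x) h"
    and "(x, y) \<in> composable X \<Longrightarrow> gmult X (actX x h) (actX y h) = actX (gmult X x y) h"
  using actX_iso[OF assms] unfolding groupoid_iso_def by auto

lemma (in groupoid_group_action) actX_inv:
  assumes x: "x \<in> arrows X" and h: "h \<in> carrier H"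
  shows "ginv X (actX x h) = actX (ginv X x) h"
proof -
  let ?a = "actX x h" and ?b = "actX (ginv X x) h"
  have a: "?a \<in> arrows X" and b: "?b \<in> arrows X"
    using actX_closed x h X.inv_closed by blast+
  have c: "(ginv X x, x) \<in> composable X" "(x, ginv X x) \<in> composable X"
    using x by (auto simp: composable_def X.inv_closed X.rng_inv X.src_inv)
  have rb: "rng X ?b = src X ?a" "src X ?b = rng X ?a"
    using x h by (simp_all add: actX_hom X.inv_closed X.rng_inv X.src_inv)
  have ab: "gmult X ?a ?b = rng X ?a"
    using c x h by (simp add: actX_hom X.mult_inv)
  have "gmult X (gmult X (ginv X ?a) ?a) ?b = gmult X (ginv X ?a) (gmult X ?a ?b)"
    using a b rb by (intro X.mult_assoc) (auto simp: composable_def X.inv_closed X.src_inv)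
  moreover have "gmult X (gmult X (ginv X ?a) ?a) ?b = ?b"
    using a b rb X.inv_mult X.rng_unit by metis
  moreover have "gmult X (ginv X ?a) (gmult X ?a ?b) = ginv X ?a"
    using a ab X.src_unit X.inv_closed X.src_inv by metis
  ultimately show ?thesis by simp
qed

lemma (in groupoid_group_action) free_cancel:
  assumes free: "free_action H (gtop X) actX" and x: "x \<in> arrows X"
    and hk: "h \<in> carrier H" "k \<in> carrier H" and eq: "actX x h = actX x k"
  shows "h = k"
proof -
  have "actX x (h \<otimes>\<^bsub>H\<^esub> inv\<^bsub>H\<^esub> k) = actX x (k \<otimes>\<^bsub>H\<^esub> inv\<^bsub>H\<^esub> k)"
    using actX_actX[OF x] hk eq by (metis H.inv_closed)
  then have "actX x (h \<otimes>\<^bsub>H\<^esub> inv\<^bsub>H\<^esub> k) = x" using hk actX_one[OF x] by simp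
  then have "h \<otimes>\<^bsub>H\<^esub> inv\<^bsub>H\<^esub> k = \<one>\<^bsub>H\<^esub>"
    using free x hk unfolding free_action_def by simp
  then show ?thesis using hk by (metis H.inv_equality H.inv_inv H.inv_closed)
qed

lemma (in groupoid_group_action) quotient_groupoid_orbits:
  shows "x \<in> arrows X \<Longrightarrow> rng (quotient_groupoid X H actX) (orbit H actX x) = orbit H actX (rng X x)"
    and "x \<in> arrows X \<Longrightarrow> src (quotient_groupoid X H actX) (orbit H actX x) = orbit H actX (src X x)"
    and "x \<in> arrows X \<Longrightarrow> ginv (quotient_groupoid X H actX) (orbit H actX x) = orbit H actX (ginv X x)"
  by (auto simp: quotient_groupoid_def orbit_def image_image actX_hom actX_inv)

lemma (in groupoid_group_action) quotient_gmult_orbits: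
  assumes free: "free_action H (gtop X) actX" and xy: "(x, y) \<in> composable X"
  shows "gmult (quotient_groupoid X H actX) (orbit H actX x) (orbit H actX y)
      = orbit H actX (gmult X x y)"
    (is "?L = ?R")
proof -
  have x: "x \<in> arrows X" and y: "y \<in> arrows X" and s: "src X x = rng X y"
    using xy by (auto simp: composable_def)
  have "src X (actX x h) = rng X (actX y k) \<longleftrightarrow> h = k"
    if "h \<in> carrier H" "k \<in> carrier H" for h k
    using that x y s free_cancel[OF free X.rng_closed[OF y]] by (auto simp: actX_hom)
  note cancel = this
  have "?L = {gmult X (actX x h) (actX y k) | h k. h \<in> carrier H \<and> k \<in> carrier H \<and> src X (actX x h) = rng X (actX y k)}"
    by (simp add: quotient_groupoid_def orbit_def) blast
  also have "\<dots> = {gmult X (actX x h) (actX y h) | h. h \<in> carrier H}"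
    using cancel by blast
  also have "\<dots> = {actX (gmult X x y) h | h. h \<in> carrier H}"
    using actX_hom(3)[OF _ xy] by metis
  also have "\<dots> = ?R" by (auto simp: orbit_def)
  finally show ?thesis .
qed

lemma (in fell_group_action) actA_facts:
  assumes "h \<in> carrier H"
  shows "a \<in> total A \<Longrightarrow> actA a h \<in> total A"
    and "a \<in> total A \<Longrightarrow> proj A (actA a h) = actX (proj A a) h"
    and "a \<in> total A \<Longrightarrow> bscale A c (actA a h) = actA (bscale A c a) h"
    and "a \<in> total A \<Longrightarrow> bnorm A (actA a h) = bnorm A a"
    and "a \<in> total A \<Longrightarrow> bstar A (actA a h) = actA (bstar A a) h"
    and "(a, b) \<in> same_fibre A \<Longrightarrow> badd A (actA a h) (actA b h) = actA (badd A a b) h"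
    and "(a, b) \<in> bcomposable X A \<Longrightarrow> bmult A (actA a h) (actA b h) = actA (bmult A a b) h"
  using actA_iso[OF assms]
  by (auto simp: fell_iso_def homeomorphic_map_def quotient_map_def)

lemma (in separable_banach_bundle) proj_closed: "a \<in> total A \<Longrightarrow> proj A a \<in> topspace T"
  using proj_surj by blast

lemma (in fell_group_action) actA_zero:
  assumes x: "x \<in> arrows X" and h: "h \<in> carrier H"
  shows "actA (bzero A x) h = bzero A (actX x h)"
proof -
  interpret F: complex_banach_space "fibre A x" by (rule fibre_banach[OF x])
  interpret F': complex_banach_space "fibre A (actX x h)"
    by (rule fibre_banach[OF actX_closed[OF x h]])
  have z: "bzero A x \<in> total A" "proj A (bzero A x) = x"
    using F.zero_closed by (auto simp: fibre_def)
  have "bnorm A (bzero A x) = 0"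
    using F.norm_eq_zero[OF F.zero_closed] by (simp add: fibre_def)
  then show ?thesis
    using F'.norm_eq_zero[of "actA (bzero A x) h"] z h by (simp add: fibre_def actA_facts)
qed

lemma (in fell_group_action) quotient_fell_orbits:
  fixes c :: complex
  defines "Q \<equiv> quotient_fell X A H actA"
  shows "a \<in> total A \<Longrightarrow> proj Q (orbit H actA a) = orbit H actX (proj A a)"
    and "a \<in> total A \<Longrightarrow> bscale Q c (orbit H actA a) = orbit H actA (bscale A c a)"
    and "a \<in> total A \<Longrightarrow> bnorm Q (orbit H actA a) = bnorm A a"
    and "a \<in> total A \<Longrightarrow> bstar Q (orbit H actA a) = orbit H actA (bstar A a)"
    and "x \<in> arrows X \<Longrightarrow> bzero Q (orbit H actX x) = orbit H actA (bzero A x)"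
proof -
  assume a: "a \<in> total A"
  have "bnorm A ` orbit H actA a = {bnorm A a}"
    using a H.one_closed by (auto simp: orbit_def image_image actA_facts)
  then show "bnorm Q (orbit H actA a) = bnorm A a" by (simp add: Q_def quotient_fell_def)
qed (auto simp: Q_def quotient_fell_def orbit_def image_image actA_facts actA_zero)

lemma (in fell_group_action) quotient_bmult_orbits:
  assumes free: "free_action H (gtop X) actX" and ab: "(a, b) \<in> bcomposable X A"
  shows "bmult (quotient_fell X A H actA) (orbit H actA a) (orbit H actA b)
      = orbit H actA (bmult A a b)"
    (is "?L = ?R")
proof -
  have a: "a \<in> total A" and b: "b \<in> total A" and s: "src X (proj A a) = rng X (proj A b)"
    using ab by (auto simp: bcomposable_def)
  have "src X (proj A (actA a h)) = rng X (proj A (actA b k)) \<longleftrightarrow> h = k"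
    if "h \<in> carrier H" "k \<in> carrier H" for h k
    using that a b s free_cancel[OF free X.rng_closed[OF proj_closed[OF b]]]
    by (auto simp: actX_hom actA_facts proj_closed)
  note cancel = this
  have "?L = {bmult A (actA a h) (actA b k) | h k. h \<in> carrier H \<and> k \<in> carrier H \<and> src X (proj A (actA a h)) = rng X (proj A (actA b k))}"
    by (simp add: quotient_fell_def orbit_def) blast
  also have "\<dots> = {bmult A (actA a h) (actA b h) | h. h \<in> carrier H}"
    using cancel by blast
  also have "\<dots> = {actA (bmult A a b) h | h. h \<in> carrier H}"
    using actA_facts(7)[OF _ ab] by metis
  also have "\<dots> = ?R" by (auto simp: orbit_def)
  finally show ?thesis .
qed

lemma (in fell_group_action) quotient_badd_orbits:
  assumes free: "free_action H (gtop X) actX" and ab: "(a, b) \<in> same_fibre A"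
  shows "badd (quotient_fell X A H actA) (orbit H actA a) (orbit H actA b)
      = orbit H actA (badd A a b)"
    (is "?L = ?R")
proof -
  have a: "a \<in> total A" and b: "b \<in> total A" and s: "proj A a = proj A b"
    using ab by (auto simp: same_fibre_def)
  have "proj A (actA a h) = proj A (actA b k) \<longleftrightarrow> h = k"
    if "h \<in> carrier H" "k \<in> carrier H" for h k
    using that a b s free_cancel[OF free proj_closed[OF b]]
    by (auto simp: actA_facts)
  note cancel = this
  have "?L = {badd A (actA a h) (actA b k) | h k. h \<in> carrier H \<and> k \<in> carrier H \<and> proj A (actA a h) = proj A (actA b k)}"
    by (simp add: quotient_fell_def orbit_def) blast
  also have "\<dots> = {badd A (actA a h) (actA b h) | h. h \<in> carrier H}"
    using cancel by blast
  also have "\<dots> = {actA (badd A a b) h | h. h \<in> carrier H}"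
    using actA_facts(6)[OF _ ab] by metis
  also have "\<dots> = ?R" by (auto simp: orbit_def)
  finally show ?thesis .
qed


section \<open>Groupoid actions and transformation bundles\<close>

locale groupoid_action =
  fixes Y :: "('y, 'm) groupoid_data_scheme" and \<Omega> :: "'u topology"
    and \<rho> :: "'u \<Rightarrow> 'y" and gact :: "'y \<Rightarrow> 'u \<Rightarrow> 'u"
  assumes moment_continuous: "continuous_map \<Omega> (unit_space Y) \<rho>"
    and moment_open: "open_map \<Omega> (unit_space Y) \<rho>"
    and gact_continuous:
      "continuous_map
         (subtopology (prod_topology (gtop Y) \<Omega>) {(y, u). src Y y = \<rho> u}) \<Omega> (\<lambda>(y, u). gact y u)"
    and moment_gact: "\<lbrakk>y \<in> arrows Y; u \<in> topspace \<Omega>; src Y y = \<rho> u\<rbrakk> \<Longrightarrow> \<rho> (gact y u) = rng Y y"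
    and gact_gact: "\<lbrakk>(y, z) \<in> composable Y; u \<in> topspace \<Omega>; src Y z = \<rho> u\<rbrakk> \<Longrightarrow>
          gact (gmult Y y z) u = gact y (gact z u)"
    and gact_unit: "u \<in> topspace \<Omega> \<Longrightarrow> gact (\<rho> u) u = u"

text \<open>The range \<open>(r(y), y\<cdot>u)\<close> and the source \<open>(s(y), u)\<close> of an arrow \<open>(y, u)\<close> are forced by the
  product and the inverse.\<close>

definition trans_groupoid ::
  "('y, 'm) groupoid_data_scheme \<Rightarrow> 'u topology \<Rightarrow> ('u \<Rightarrow> 'y) \<Rightarrow> ('y \<Rightarrow> 'u \<Rightarrow> 'u) \<Rightarrow>
   ('y \<times> 'u) groupoid_data" where
  "trans_groupoid Y \<Omega> \<rho> gact = \<lparr>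
     gtop = subtopology (prod_topology (gtop Y) \<Omega>) {(y, u). src Y y = \<rho> u},
     rng = (\<lambda>(y, u). (rng Y y, gact y u)),
     src = (\<lambda>(y, u). (src Y y, u)),
     gmult = (\<lambda>(y, v) (z, u). (gmult Y y z, u)),
     ginv = (\<lambda>(y, u). (ginv Y y, gact y u))\<rparr>"

definition trans_fell ::
  "('y, 'm) groupoid_data_scheme \<Rightarrow> ('b, 'y, 'n) fell_data_scheme \<Rightarrow> 'u topology \<Rightarrow> ('u \<Rightarrow> 'y) \<Rightarrow>
   ('y \<Rightarrow> 'u \<Rightarrow> 'u) \<Rightarrow> ('b \<times> 'u, 'y \<times> 'u) fell_data" where
  "trans_fell Y B \<Omega> \<rho> gact = \<lparr>
     btop = subtopology (prod_topology (btop B) \<Omega>) {(b, u). src Y (proj B b) = \<rho> u},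
     proj = (\<lambda>(b, u). (proj B b, u)),
     badd = (\<lambda>(a, v) (b, u). (badd B a b, u)),
     bscale = (\<lambda>c (b, u). (bscale B c b, u)),
     bzero = (\<lambda>(y, u). (bzero B y, u)),
     bnorm = (\<lambda>(b, u). bnorm B b),
     bmult = (\<lambda>(a, v) (b, u). (bmult B a b, u)),
     bstar = (\<lambda>(b, u). (bstar B b, gact (proj B b) u))\<rparr>"

text \<open>\<open>H\<close> acts on the transformation bundle and groupoid over \<open>\<Omega>\<close> through the second coordinate,
  which requires the following compatibility with the \<open>Y\<close>-action.\<close>

definition commuting_actions ::
  "('y, 'm) groupoid_data_scheme \<Rightarrow> 'u topology \<Rightarrow> ('u \<Rightarrow> 'y) \<Rightarrow> ('y \<Rightarrow> 'u \<Rightarrow> 'u) \<Rightarrow>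
   ('h, 'k) monoid_scheme \<Rightarrow> ('u \<Rightarrow> 'h \<Rightarrow> 'u) \<Rightarrow> bool" where
  "commuting_actions Y \<Omega> \<rho> gact H hact \<longleftrightarrow>
     (\<forall>u\<in>topspace \<Omega>. \<forall>h\<in>carrier H. \<rho> (hact u h) = \<rho> u) \<and>
     (\<forall>y\<in>arrows Y. \<forall>u\<in>topspace \<Omega>. \<forall>h\<in>carrier H. src Y y = \<rho> u \<longrightarrow>
        gact y (hact u h) = hact (gact y u) h)"

definition second_act :: "('u \<Rightarrow> 'h \<Rightarrow> 'u) \<Rightarrow> 'b \<times> 'u \<Rightarrow> 'h \<Rightarrow> 'b \<times> 'u" where
  "second_act hact = (\<lambda>(b, u) h. (b, hact u h))"

definition equivariant_on ::
  "('h, 'k) monoid_scheme \<Rightarrow> 'a set \<Rightarrow> ('a \<Rightarrow> 'h \<Rightarrow> 'a) \<Rightarrow> ('b \<Rightarrow> 'h \<Rightarrow> 'b) \<Rightarrow> ('a \<Rightarrow> 'b) \<Rightarrow> bool" where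
  "equivariant_on H S act act' f \<longleftrightarrow> (\<forall>a\<in>S. \<forall>h\<in>carrier H. f (act a h) = act' (f a) h)"

end

theory Submission
  imports Defs
begin

text \<open>
  For a unit \<open>u\<close> and an orbit \<open>y = x\<cdot>H\<close> with \<open>s(x)\<cdot>H = u\<cdot>H\<close>, freeness singles out one representative
  \<open>x'\<close> of \<open>y\<close> with \<open>s(x') = u\<close>, and \<open>y\<cdot>u = r(x')\<close> defines the action of \<open>X/H\<close> on the unit space,
  with the orbit map as moment map.  The isomorphisms are \<open>x \<mapsto> (x\<cdot>H, s(x))\<close> and
  \<open>a \<mapsto> (a\<cdot>H, s(a))\<close>; that they respect the algebraic structure is a computation with
  representatives.

  The topological content is that both maps are homeomorphisms, and this is one statement,
  \<open>homeomorphic_map_orbit_pair\<close>: if \<open>f : T \<rightarrow> S\<close> is continuous and equivariant and the action on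
  \<open>S\<close> is free and proper, then \<open>t \<mapsto> (t\<cdot>H, f(t))\<close> identifies \<open>T\<close> with the pullback of \<open>T/H \<rightarrow> S/H\<close> along
  \<open>S \<rightarrow> S/H\<close>.  It is used for \<open>T = X\<close> and \<open>T = A\<close>, both times with \<open>S = X\<close> and \<open>f\<close> the source
  map.  Openness of the map is where properness enters: close points of one orbit in \<open>S\<close>
  differ by a group element close to the identity (\<open>translation_near_one\<close>).  Once the
  homeomorphism for \<open>X\<close> is known, the action map on the unit space is the range map composed
  with its inverse, hence continuous.
\<close>

section \<open>Continuous group actions and pullbacks of orbit spaces\<close>

lemma openin_prod_box:
  assumes "openin (prod_topology S T) W" "(x, y) \<in> W"
  obtains U V where "openin S U" "openin T V" "x \<in> U" "y \<in> V" "U \<times> V \<subseteq> W"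
  using assms unfolding openin_prod_topology_alt by blast

text \<open>Both \<open>X\<close> and \<open>A\<close> carry such an action; treating them alike requires forgetting the
  groupoid structure.\<close>

locale right_action = H: lc_group H TH
  for H :: "('h, 'k) monoid_scheme" and TH :: "'h topology" +
  fixes T :: "'t topology" and act :: "'t \<Rightarrow> 'h \<Rightarrow> 't"
  assumes act_continuous: "continuous_map (prod_topology T TH) T (\<lambda>(t, h). act t h)"
    and act_one: "t \<in> topspace T \<Longrightarrow> act t \<one>\<^bsub>H\<^esub> = t"
    and act_act: "\<lbrakk>t \<in> topspace T; h \<in> carrier H; k \<in> carrier H\<rbrakk>
          \<Longrightarrow> act (act t h) k = act t (h \<otimes>\<^bsub>H\<^esub> k)"
begin

lemma act_closed: "\<lbrakk>t \<in> topspace T; h \<in> carrier H\<rbrakk> \<Longrightarrow> act t h \<in> topspace T"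
  using continuous_map_funspace[OF act_continuous] H.topspace_group by (auto simp: Pi_iff)

lemma act_inverse:
  assumes "t \<in> topspace T" "h \<in> carrier H" shows "act (act t h) (inv\<^bsub>H\<^esub> h) = t"
  using assms by (simp add: act_act act_one)

lemma in_own_orbit: "t \<in> topspace T \<Longrightarrow> t \<in> orbit H act t"
  unfolding orbit_def by (metis H.one_closed act_one imageI)

lemma orbit_act:
  assumes t: "t \<in> topspace T" and h: "h \<in> carrier H"
  shows "orbit H act (act t h) = orbit H act t"
proof -
  have sub: "orbit H act (act t' k) \<subseteq> orbit H act t'"
    if "t' \<in> topspace T" "k \<in> carrier H" for t' k
    using that by (auto simp: orbit_def act_act)
  from sub[of "act t h" "inv\<^bsub>H\<^esub> h"] show ?thesis
    using sub[OF t h] t h by (simp add: act_closed act_inverse)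
qed

lemma orbit_eq_iff:
  assumes "t \<in> topspace T" "t' \<in> topspace T"
  shows "orbit H act t = orbit H act t' \<longleftrightarrow> (\<exists>h\<in>carrier H. t' = act t h)"
proof
  assume "orbit H act t = orbit H act t'"
  then have "t' \<in> orbit H act t" using in_own_orbit assms by simp
  then show "\<exists>h\<in>carrier H. t' = act t h" by (auto simp: orbit_def)
qed (use assms orbit_act in auto)

lemma continuous_act_fixed:
  assumes h: "h \<in> carrier H" shows "continuous_map T T (\<lambda>t. act t h)"
proof -
  have "continuous_map T (prod_topology T TH) (\<lambda>t. (t, h))"
    using h by (simp add: continuous_map_pairedI H.topspace_group)
  from continuous_map_compose[OF this act_continuous] show ?thesis by (simp add: o_def)
qed

text \<open>The saturation of an open set is the union of its translates.\<close>

lemma open_map_orbit: "open_map T (quotient_topology T (orbit H act)) (orbit H act)"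
  unfolding open_map_def openin_quotient_topology
proof (intro allI impI conjI)
  fix U assume U: "openin T U"
  have UT: "U \<subseteq> topspace T" using U by (rule openin_subset)
  then show "orbit H act ` U \<subseteq> orbit H act ` topspace T" by blast
  have "{t \<in> topspace T. orbit H act t \<in> orbit H act ` U}
      = (\<Union>h\<in>carrier H. {t \<in> topspace T. act t h \<in> U})" (is "?L = ?R")
  proof
    show "?L \<subseteq> ?R"
    proof
      fix t assume "t \<in> ?L"
      then obtain u where u: "t \<in> topspace T" "u \<in> U" "orbit H act t = orbit H act u" by auto
      then obtain h where "h \<in> carrier H" "u = act t h" using orbit_eq_iff[of t u] UT by auto
      then show "t \<in> ?R" using u by blast
    qed
    show "?R \<subseteq> ?L"
    proof
      fix t assume "t \<in> ?R"
      then obtain h where h: "t \<in> topspace T" "h \<in> carrier H" "act t h \<in> U" by auto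
      then have "orbit H act t = orbit H act (act t h)" using orbit_act by simp
      then show "t \<in> ?L" using h by blast
    qed
  qed
  moreover have "openin T ?R"
    using openin_continuous_map_preimage[OF continuous_act_fixed U] by (intro openin_Union) auto
  ultimately show "openin T {t \<in> topspace T. orbit H act t \<in> orbit H act ` U}" by simp
qed

lemma continuous_map_orbit:
  "continuous_map T (quotient_topology T (orbit H act)) (orbit H act)"
  by (rule quotient_imp_continuous_map[OF quotient_map_quotient_topology])

text \<open>A proper map is closed, so the pairs \<open>(t, t\<cdot>h)\<close> with \<open>h\<close> outside \<open>N\<close> form a closed set;
  by freeness it misses the diagonal.\<close>

lemma translation_near_one:
  assumes free: "free_action H T act" and proper: "proper_action TH T act"
    and t: "t \<in> topspace T" and N: "openin TH N" "\<one>\<^bsub>H\<^esub> \<in> N"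
  obtains V where "openin T V" "t \<in> V"
    "\<And>v h. \<lbrakk>v \<in> V; h \<in> carrier H; act v h \<in> V\<rbrakk> \<Longrightarrow> h \<in> N"
proof -
  let ?\<theta> = "\<lambda>(x, h). (x, act x h)"
  let ?C = "?\<theta> ` (topspace T \<times> (topspace TH - N))"
  have "closed_map (prod_topology T TH) (prod_topology T T) ?\<theta>"
    using proper by (simp add: proper_action_def proper_map_def)
  moreover have "closedin (prod_topology T TH) (topspace T \<times> (topspace TH - N))"
    using N by (simp add: closedin_prod_Times_iff closedin_diff)
  ultimately have "closedin (prod_topology T T) ?C" by (simp add: closed_map_def)
  then have op: "openin (prod_topology T T) (topspace (prod_topology T T) - ?C)" by blast
  have "(t, t) \<notin> ?C"
    using free t N(2) H.topspace_group by (force simp: free_action_def)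
  then have "(t, t) \<in> topspace (prod_topology T T) - ?C" using t by simp
  from openin_prod_box[OF op this] obtain V1 V2 where V: "openin T V1" "openin T V2" "t \<in> V1"
      "t \<in> V2" "V1 \<times> V2 \<subseteq> topspace (prod_topology T T) - ?C" .
  show thesis
  proof
    show "openin T (V1 \<inter> V2)" "t \<in> V1 \<inter> V2" using V by auto
    fix v h assume v: "v \<in> V1 \<inter> V2" and h: "h \<in> carrier H" and a: "act v h \<in> V1 \<inter> V2"
    show "h \<in> N"
    proof (rule ccontr)
      assume "h \<notin> N"
      then have "(v, act v h) \<in> ?C"
        using v h V(1) H.topspace_group openin_subset by force
      then show False using v a V(5) by blast
    qed
  qed
qed

end

text \<open>The set constraint \<open>f ` q = u\<cdot>H\<close> says that \<open>q\<close> and \<open>u\<close> have the same image in \<open>S/H\<close>.\<close>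

lemma homeomorphic_map_orbit_pair:
  assumes actT: "right_action H TH T act" and actS: "right_action H TH S sact"
    and free: "free_action H S sact" and proper: "proper_action TH S sact"
    and f: "continuous_map T S f" and fU: "f ` topspace T \<subseteq> U"
    and equi: "\<And>t h. \<lbrakk>t \<in> topspace T; h \<in> carrier H\<rbrakk> \<Longrightarrow> f (act t h) = sact (f t) h"
  shows "homeomorphic_map T
     (subtopology (prod_topology (quotient_topology T (orbit H act)) (subtopology S U))
        {(q, u). f ` q = orbit H sact u})
     (\<lambda>t. (orbit H act t, f t))"
    (is "homeomorphic_map T (subtopology ?P ?D) ?F")
proof -
  interpret T: right_action H TH T act by (rule actT)
  interpret S: right_action H TH S sact by (rule actS)
  have fS: "f t \<in> topspace S" if "t \<in> topspace T" for t
    using f that by (simp add: continuous_map_def Pi_iff)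
  have f_orbit: "f ` orbit H act t = orbit H sact (f t)" if "t \<in> topspace T" for t
    unfolding orbit_def image_image using equi[OF that] by (rule image_cong[OF refl])
  have inj: "inj_on ?F (topspace T)"
  proof (rule inj_onI)
    fix t t' assume t: "t \<in> topspace T" "t' \<in> topspace T" and eq: "?F t = ?F t'"
    then obtain h where h: "h \<in> carrier H" "t' = act t h"
      using T.orbit_eq_iff[OF t] by auto
    then have "sact (f t) h = f t" using eq equi t by auto
    then have "h = \<one>\<^bsub>H\<^esub>" using free fS t h by (auto simp: free_action_def)
    then show "t = t'" using h t T.act_one by simp
  qed
  have contF: "continuous_map T (subtopology ?P ?D) ?F"
    using f fU[unfolded image_subset_iff] T.continuous_map_orbit f_orbit
    by (auto simp: continuous_map_in_subtopology intro!: continuous_map_pairedI)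
  \<comment> \<open>Every point of the pullback near \<open>?F t\<close> has the form \<open>?F (act t' h)\<close> with \<open>t'\<close> near \<open>t\<close>;
    since \<open>f t'\<close> and its translate by \<open>h\<close> are both near \<open>f t\<close>, \<open>h\<close> is near the identity.\<close>
  have locally_onto: "\<exists>G. openin ?P G \<and> ?F t \<in> G \<and> G \<inter> ?D \<subseteq> ?F ` W"
    if W: "openin T W" and tW: "t \<in> W" for W t
  proof -
    have t: "t \<in> topspace T" using W tW openin_subset by blast
    let ?E = "{z \<in> topspace (prod_topology T TH). (case z of (t, h) \<Rightarrow> act t h) \<in> W}"
    have "openin (prod_topology T TH) ?E"
      using T.act_continuous W by (rule openin_continuous_map_preimage)
    moreover have "(t, \<one>\<^bsub>H\<^esub>) \<in> ?E" using t tW T.act_one T.H.topspace_group by simp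
    ultimately obtain W1 N where W1: "openin T W1" and N: "openin TH N" and tW1: "t \<in> W1"
      and oneN: "\<one>\<^bsub>H\<^esub> \<in> N" and WN: "W1 \<times> N \<subseteq> ?E"
      by (rule openin_prod_box)
    obtain V where V: "openin S V" "f t \<in> V"
        "\<And>v h. \<lbrakk>v \<in> V; h \<in> carrier H; sact v h \<in> V\<rbrakk> \<Longrightarrow> h \<in> N"
      using S.translation_near_one[OF free proper fS[OF t] N oneN] by blast
    let ?W2 = "W1 \<inter> {t \<in> topspace T. f t \<in> V}"
    let ?G = "(orbit H act ` ?W2) \<times> (V \<inter> U)"
    have "openin T ?W2" using W1 openin_continuous_map_preimage[OF f V(1)] by blast
    then have "openin (quotient_topology T (orbit H act)) (orbit H act ` ?W2)"
      using T.open_map_orbit by (simp add: open_map_def)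
    moreover have "openin (subtopology S U) (V \<inter> U)" using V by (auto simp: openin_subtopology)
    ultimately have "openin ?P ?G" by (simp add: openin_prod_Times_iff)
    moreover have "?F t \<in> ?G" using t tW1 V(2) fU by auto
    moreover have "?G \<inter> ?D \<subseteq> ?F ` W"
    proof
      fix z assume "z \<in> ?G \<inter> ?D"
      then obtain t' u where z: "z = (orbit H act t', u)" and t': "t' \<in> W1" "t' \<in> topspace T"
        "f t' \<in> V" and u: "u \<in> V" and "f ` orbit H act t' = orbit H sact u" by auto
      then have "orbit H sact (f t') = orbit H sact u" using f_orbit by simp
      then obtain h where h: "h \<in> carrier H" "u = sact (f t') h"
        using S.orbit_eq_iff[of "f t'" u] fS t' u openin_subset[OF V(1)] by auto
      then have "h \<in> N" using V(3)[OF t'(3)] u by blast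
      then have "(t', h) \<in> ?E" using t'(1) WN by blast
      then have "act t' h \<in> W" by simp
      moreover have "?F (act t' h) = z" using z h t' equi T.orbit_act by simp
      ultimately show "z \<in> ?F ` W" by blast
    qed
    ultimately show ?thesis by blast
  qed
  have openF: "open_map T (subtopology ?P ?D) ?F"
    unfolding open_map_def
  proof (intro allI impI)
    fix W assume W: "openin T W"
    have WT: "W \<subseteq> topspace T" using W by (rule openin_subset)
    show "openin (subtopology ?P ?D) (?F ` W)"
    proof (subst openin_subopen, intro ballI)
      fix z assume "z \<in> ?F ` W"
      then obtain t where t: "t \<in> W" "z = ?F t" by blast
      from locally_onto[OF W t(1)] obtain G where G: "openin ?P G" "?F t \<in> G" "G \<inter> ?D \<subseteq> ?F ` W"
        by blast
      have "z \<in> ?D" using t f_orbit WT by auto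
      then show "\<exists>R. openin (subtopology ?P ?D) R \<and> z \<in> R \<and> R \<subseteq> ?F ` W"
        using G t(2) by (intro exI[of _ "G \<inter> ?D"]) (blast intro: openin_subtopology_Int)
    qed
  qed
  have "z \<in> ?F ` topspace T" if "z \<in> topspace (subtopology ?P ?D)" for z
  proof -
    obtain q u where qu: "z = (q, u)" by (cases z)
    then have u: "u \<in> topspace S" and "q \<in> orbit H act ` topspace T"
      and fq: "f ` q = orbit H sact u"
      using that by (simp_all add: topspace_quotient_topology)
    then obtain t where t: "t \<in> topspace T" "q = orbit H act t" by blast
    then have "orbit H sact (f t) = orbit H sact u" using fq f_orbit by simp
    then obtain h where h: "h \<in> carrier H" "u = sact (f t) h"
      using S.orbit_eq_iff[OF fS[OF t(1)] u] by auto
    have "?F (act t h) = z" using qu h t(2) equi[OF t(1) h(1)] T.orbit_act[OF t(1) h(1)] by simp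
    then show ?thesis using T.act_closed[OF t(1) h(1)] by blast
  qed
  moreover have "?F ` topspace T \<subseteq> topspace (subtopology ?P ?D)"
    using continuous_map_image_subset_topspace[OF contF] .
  ultimately have "?F ` topspace T = topspace (subtopology ?P ?D)" by blast
  then show ?thesis
    using contF openF inj by (intro bijective_open_imp_homeomorphic_map)
qed


section \<open>The action of the quotient groupoid on the unit space\<close>

lemma (in lc_groupoid) continuous_src: "continuous_map (gtop G) (gtop G) (src G)"
proof -
  have "continuous_map (gtop G) (subtopology (prod_topology (gtop G) (gtop G)) (composable G))
      (\<lambda>x. (ginv G x, x))"
    using continuous_inv
    by (auto simp: continuous_map_in_subtopology composable_def inv_closed src_inv
        intro!: continuous_map_pairedI)
  from continuous_map_compose[OF this continuous_mult]
  show ?thesis by (rule continuous_map_eq) (simp add: inv_mult)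
qed

lemma (in lc_groupoid) continuous_rng: "continuous_map (gtop G) (gtop G) (rng G)"
  using continuous_map_compose[OF continuous_inv continuous_src]
  by (rule continuous_map_eq) (simp add: src_inv)

lemma (in lc_groupoid) src_in_gunits: "x \<in> arrows G \<Longrightarrow> src G x \<in> gunits G"
  unfolding gunits_def by (metis image_eqI rng_src src_closed)

lemma (in lc_groupoid) gunitsD:
  assumes "u \<in> gunits G" shows "u \<in> arrows G" "rng G u = u" "src G u = u"
  using assms by (auto simp: gunits_def rng_closed rng_rng src_rng)

lemma (in lc_groupoid) topspace_unit_space: "topspace (unit_space G) = gunits G"
  using gunitsD(1) by (auto simp: unit_space_def)

sublocale groupoid_group_action \<subseteq> actX: right_action H TH "gtop X" actX
  by unfold_locales (use actX_continuous actX_one actX_actX in auto)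

text \<open>Meaningful if \<open>q\<close> is an orbit with \<open>s(q) = u\<cdot>H\<close>; for a free action the arrow described is
  then unique.\<close>

definition unit_act :: "('x, 'm) groupoid_data_scheme \<Rightarrow> 'x set \<Rightarrow> 'x \<Rightarrow> 'x" where
  "unit_act X q u = rng X (THE x. x \<in> q \<and> src X x = u)"

locale free_proper_groupoid_action = groupoid_group_action X H TH actX
  for X :: "('x, 'm) groupoid_data_scheme" and H :: "('h, 'k) monoid_scheme"
    and TH :: "'h topology" and actX :: "'x \<Rightarrow> 'h \<Rightarrow> 'x" +
  assumes free: "free_action H (gtop X) actX" and proper: "proper_action TH (gtop X) actX"
begin

abbreviation "Y \<equiv> quotient_groupoid X H actX"

lemma arrows_quotient: "arrows Y = orbit H actX ` arrows X"
  by (simp add: quotient_groupoid_def topspace_quotient_topology)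

lemma gunits_quotient: "gunits Y = orbit H actX ` gunits X"
  by (auto simp: gunits_def arrows_quotient image_image quotient_groupoid_orbits)

lemma unit_act_orbit:
  assumes x: "x \<in> arrows X" shows "unit_act X (orbit H actX x) (src X x) = rng X x"
proof -
  have "(THE z. z \<in> orbit H actX x \<and> src X z = src X x) = x"
  proof (rule the_equality)
    show "x \<in> orbit H actX x \<and> src X x = src X x" using actX.in_own_orbit[OF x] by simp
    fix z assume z: "z \<in> orbit H actX x \<and> src X z = src X x"
    then obtain h where h: "h \<in> carrier H" "z = actX x h" by (auto simp: orbit_def)
    then have "actX (src X x) h = src X x" using z x actX_hom by simp
    then have "h = \<one>\<^bsub>H\<^esub>" using free X.src_closed[OF x] h(1) unfolding free_action_def by blast
    then show "z = x" using h x actX_one by simp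
  qed
  then show ?thesis by (simp add: unit_act_def)
qed

text \<open>Every pair to which the action applies has this form, which turns the axioms of the action
  into identities for representatives.\<close>

lemma composable_with_unit:
  assumes q: "q \<in> arrows Y" and u: "u \<in> gunits X" and s: "src Y q = orbit H actX u"
  obtains x where "x \<in> arrows X" "q = orbit H actX x" "src X x = u"
proof -
  obtain x where x: "x \<in> arrows X" "q = orbit H actX x" using q arrows_quotient by blast
  then have "orbit H actX (src X x) = orbit H actX u" using s quotient_groupoid_orbits by simp
  then obtain h where "h \<in> carrier H" "u = actX (src X x) h"
    using actX.orbit_eq_iff x u X.src_closed X.gunitsD by blast
  then show thesis
    using x actX_hom actX_closed actX.orbit_act by (intro that[of "actX x h"]) auto
qed

text \<open>Translates of units are units, so the unit space of \<open>X\<close> is saturated and the orbit map stays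
  open when restricted to it.\<close>

lemma open_map_orbit_units: "open_map (unit_space X) (unit_space Y) (orbit H actX)"
  unfolding open_map_def
proof (intro allI impI)
  fix W assume "openin (unit_space X) W"
  then obtain W' where W': "openin (gtop X) W'" "W = W' \<inter> gunits X"
    by (auto simp: unit_space_def openin_subtopology)
  have "orbit H actX ` W = orbit H actX ` W' \<inter> gunits Y"
  proof
    show "orbit H actX ` W \<subseteq> orbit H actX ` W' \<inter> gunits Y" using W' gunits_quotient by blast
    show "orbit H actX ` W' \<inter> gunits Y \<subseteq> orbit H actX ` W"
    proof
      fix q assume "q \<in> orbit H actX ` W' \<inter> gunits Y"
      then obtain w u where w: "w \<in> W'" "q = orbit H actX w" "u \<in> gunits X" "q = orbit H actX u"
        using gunits_quotient by auto
      then obtain h where h: "h \<in> carrier H" "w = actX u h"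
        using actX.orbit_eq_iff[of u w] W' X.gunitsD openin_subset by blast
      then have "rng X w = w" using actX_hom(1) X.gunitsD w(3) by simp
      then have "w \<in> gunits X"
        unfolding gunits_def using w(1) W'(1) openin_subset by (metis image_eqI subsetD)
      then show "q \<in> orbit H actX ` W" using w W' by blast
    qed
  qed
  moreover have "openin (gtop Y) (orbit H actX ` W')"
    using actX.open_map_orbit W' by (simp add: quotient_groupoid_def open_map_def)
  ultimately show "openin (unit_space Y) (orbit H actX ` W)"
    by (auto simp: unit_space_def openin_subtopology)
qed

abbreviation "YX \<equiv> trans_groupoid Y (unit_space X) (orbit H actX) (unit_act X)"

lemma homeomorphic_map_arrows:
  "homeomorphic_map (gtop X) (gtop YX) (\<lambda>x. (orbit H actX x, src X x))"
proof -
  have "homeomorphic_map (gtop X)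
     (subtopology (prod_topology (quotient_topology (gtop X) (orbit H actX))
        (subtopology (gtop X) (gunits X))) {(q, u). src X ` q = orbit H actX u})
     (\<lambda>x. (orbit H actX x, src X x))"
    using actX.right_action_axioms actX.right_action_axioms free proper X.continuous_src
    by (rule homeomorphic_map_orbit_pair) (auto simp: X.src_in_gunits actX_hom)
  then show ?thesis by (simp add: trans_groupoid_def unit_space_def quotient_groupoid_def)
qed

lemma quotient_groupoid_action:
  "groupoid_action Y (unit_space X) (orbit H actX) (unit_act X)"
proof
  show "continuous_map (unit_space X) (unit_space Y) (orbit H actX)"
  proof -
    have "continuous_map (unit_space X) (gtop Y) (orbit H actX)"
      using actX.continuous_map_orbit
      by (simp add: unit_space_def quotient_groupoid_def continuous_map_from_subtopology)
    then show ?thesis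
      using X.topspace_unit_space gunits_quotient
      by (auto simp: unit_space_def[of Y] continuous_map_in_subtopology)
  qed
  show "open_map (unit_space X) (unit_space Y) (orbit H actX)"
    by (rule open_map_orbit_units)
  show "continuous_map (subtopology (prod_topology (gtop Y) (unit_space X))
      {(y, u). src Y y = orbit H actX u}) (unit_space X) (\<lambda>(y, u). unit_act X y u)"
  proof -
    have "continuous_map (gtop X) (unit_space X) (rng X)"
      using X.continuous_rng by (auto simp: unit_space_def continuous_map_in_subtopology gunits_def)
    then have "continuous_map (gtop X) (unit_space X)
        ((\<lambda>(y, u). unit_act X y u) \<circ> (\<lambda>x. (orbit H actX x, src X x)))"
      by (rule continuous_map_eq) (simp add: unit_act_orbit)
    moreover have "quotient_map (gtop X) (gtop YX) (\<lambda>x. (orbit H actX x, src X x))"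
      using homeomorphic_map_arrows unfolding homeomorphic_map_def by (rule conjunct1)
    ultimately have "continuous_map (gtop YX) (unit_space X) (\<lambda>(y, u). unit_act X y u)"
      by (rule continuous_compose_quotient_map[rotated])
    then show ?thesis by (simp add: trans_groupoid_def)
  qed
next
  fix y u assume "y \<in> arrows Y" "u \<in> topspace (unit_space X)" "src Y y = orbit H actX u"
  then obtain x where "x \<in> arrows X" "y = orbit H actX x" "src X x = u"
    using composable_with_unit X.topspace_unit_space by blast
  then show "orbit H actX (unit_act X y u) = rng Y y"
    using unit_act_orbit quotient_groupoid_orbits by auto
next
  fix y z u assume yz: "(y, z) \<in> composable Y" and u: "u \<in> topspace (unit_space X)"
    and s: "src Y z = orbit H actX u"
  have "z \<in> arrows Y" "y \<in> arrows Y" "src Y y = rng Y z" using yz by (auto simp: composable_def)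
  moreover then obtain x where x: "x \<in> arrows X" "z = orbit H actX x" "src X x = u"
    using composable_with_unit X.topspace_unit_space u s by blast
  moreover have "rng X x \<in> gunits X" using x by (simp add: gunits_def)
  ultimately obtain w where w: "w \<in> arrows X" "y = orbit H actX w" "src X w = rng X x"
    using composable_with_unit quotient_groupoid_orbits by metis
  then have wx: "(w, x) \<in> composable X" using x by (simp add: composable_def)
  have "unit_act X (gmult Y y z) u = unit_act X (orbit H actX (gmult X w x)) (src X (gmult X w x))"
    using w x wx quotient_gmult_orbits[OF free wx] X.src_mult by simp
  also have "\<dots> = rng X w" using unit_act_orbit X.mult_closed X.rng_mult wx by simp
  also have "\<dots> = unit_act X y (unit_act X z u)" using unit_act_orbit w x by metis
  finally show "unit_act X (gmult Y y z) u = unit_act X y (unit_act X z u)" .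
next
  fix u assume "u \<in> topspace (unit_space X)"
  then show "unit_act X (orbit H actX u) u = u"
    using unit_act_orbit[of u] X.topspace_unit_space X.gunitsD by simp
qed

lemma unit_act_commutes: "commuting_actions Y (unit_space X) (orbit H actX) (unit_act X) H actX"
  unfolding commuting_actions_def
proof (intro conjI ballI impI)
  fix u h assume "u \<in> topspace (unit_space X)" "h \<in> carrier H"
  then show "orbit H actX (actX u h) = orbit H actX u"
    using actX.orbit_act X.topspace_unit_space X.gunitsD by simp
next
  fix y u h assume y: "y \<in> arrows Y" and u: "u \<in> topspace (unit_space X)" and h: "h \<in> carrier H"
    and s: "src Y y = orbit H actX u"
  obtain x where x: "x \<in> arrows X" "y = orbit H actX x" "src X x = u"
    using composable_with_unit X.topspace_unit_space y u s by blast
  have "unit_act X y (actX u h) = unit_act X (orbit H actX (actX x h)) (src X (actX x h))"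
    using x h actX.orbit_act actX_hom by simp
  also have "\<dots> = actX (rng X x) h"
    using unit_act_orbit[OF actX_closed[OF x(1) h]] actX_hom(1)[OF h x(1)] by simp
  also have "\<dots> = actX (unit_act X y u) h" using x unit_act_orbit by metis
  finally show "unit_act X y (actX u h) = actX (unit_act X y u) h" .
qed

lemma groupoid_iso_transformation:
  "groupoid_iso X YX (\<lambda>x. (orbit H actX x, src X x))"
  unfolding groupoid_iso_def
  using homeomorphic_map_arrows
  by (auto simp: trans_groupoid_def quotient_groupoid_orbits unit_act_orbit X.src_rng X.src_src
      X.src_mult quotient_gmult_orbits[OF free])

end


section \<open>The isomorphism with the transformation bundle\<close>

lemma (in separable_banach_bundle) proj_badd:
  assumes "(a, b) \<in> same_fibre A" shows "badd A a b \<in> total A" "proj A (badd A a b) = proj A b"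
proof -
  interpret F: complex_banach_space "fibre A (proj A b)"
    using assms by (intro fibre_banach proj_closed) (simp add: same_fibre_def)
  show "badd A a b \<in> total A" "proj A (badd A a b) = proj A b"
    using F.add_closed[of a b] assms by (auto simp: fibre_def same_fibre_def)
qed

lemma (in separable_banach_bundle) proj_bscale:
  assumes "a \<in> total A" shows "bscale A c a \<in> total A" "proj A (bscale A c a) = proj A a"
proof -
  interpret F: complex_banach_space "fibre A (proj A a)"
    using assms by (intro fibre_banach proj_closed)
  show "bscale A c a \<in> total A" "proj A (bscale A c a) = proj A a"
    using F.scale_closed[of a c] assms by (auto simp: fibre_def)
qed

text \<open>The identity acts on \<open>A\<close> as an injective idempotent.\<close>

lemma (in fell_group_action) actA_one:
  assumes a: "a \<in> total A" shows "actA a \<one>\<^bsub>H\<^esub> = a"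
proof -
  have "inj_on (\<lambda>a. actA a \<one>\<^bsub>H\<^esub>) (total A)"
    using actA_iso[OF H.one_closed] by (simp add: fell_iso_def homeomorphic_map_def)
  moreover have "actA (actA a \<one>\<^bsub>H\<^esub>) \<one>\<^bsub>H\<^esub> = actA a \<one>\<^bsub>H\<^esub>"
    using actA_actA[OF a H.one_closed H.one_closed] by simp
  ultimately show ?thesis using actA_facts(1)[OF H.one_closed a] a by (meson inj_onD)
qed

sublocale fell_group_action \<subseteq> actA: right_action H TH "btop A" actA
  by unfold_locales (use actA_continuous actA_one actA_actA in auto)

locale free_proper_fell_action = fell_group_action X A H TH actX actA +
    free_proper_groupoid_action X H TH actX
  for X :: "('x, 'm) groupoid_data_scheme" and A :: "('a, 'x, 'n) fell_data_scheme"
    and H :: "('h, 'k) monoid_scheme" and TH :: "'h topology"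
    and actX :: "'x \<Rightarrow> 'h \<Rightarrow> 'x" and actA :: "'a \<Rightarrow> 'h \<Rightarrow> 'a"
begin

abbreviation "B \<equiv> quotient_fell X A H actA"

abbreviation "BX \<equiv> trans_fell Y B (unit_space X) (orbit H actX) (unit_act X)"

lemma homeomorphic_map_total:
  "homeomorphic_map (btop A) (btop BX) (\<lambda>a. (orbit H actA a, src X (proj A a)))"
proof -
  have cont: "continuous_map (btop A) (gtop X) (\<lambda>a. src X (proj A a))"
    using continuous_map_compose[OF proj_continuous X.continuous_src] by (simp add: o_def)
  have "homeomorphic_map (btop A)
     (subtopology (prod_topology (quotient_topology (btop A) (orbit H actA))
        (subtopology (gtop X) (gunits X))) {(q, u). (\<lambda>a. src X (proj A a)) ` q = orbit H actX u})
     (\<lambda>a. (orbit H actA a, src X (proj A a)))"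
    using actA.right_action_axioms actX.right_action_axioms free proper cont
    by (rule homeomorphic_map_orbit_pair)
      (auto simp: X.src_in_gunits actX_hom actA_facts proj_closed)
  then show ?thesis
    by (simp add: trans_fell_def unit_space_def quotient_groupoid_def quotient_fell_def image_image)
qed

lemma fell_iso_transformation:
  "fell_iso X A YX BX (\<lambda>x. (orbit H actX x, src X x)) (\<lambda>a. (orbit H actA a, src X (proj A a)))"
proof -
  have mult: "src X (proj A (bmult A a b)) = src X (proj A b)" if "(a, b) \<in> bcomposable X A" for a b
    using that proj_bmult[OF that] X.src_mult
    by (simp add: bcomposable_def composable_def proj_closed)
  have star: "src X (proj A (bstar A a)) = unit_act X (orbit H actX (proj A a)) (src X (proj A a))"
    if "a \<in> total A" for a
    using that by (simp add: proj_bstar X.src_inv unit_act_orbit proj_closed)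
  show ?thesis
    unfolding fell_iso_def
    using groupoid_iso_transformation homeomorphic_map_total
    by (auto simp: trans_fell_def quotient_fell_orbits quotient_badd_orbits[OF free]
        quotient_bmult_orbits[OF free] proj_badd proj_bscale mult star)
qed

end

theorem theoremA11:
  fixes X :: "'x groupoid_data" and A :: "('a, 'x) fell_data"
    and H :: "'h monoid" and TH :: "'h topology"
    and actX :: "'x \<Rightarrow> 'h \<Rightarrow> 'x" and actA :: "'a \<Rightarrow> 'h \<Rightarrow> 'a"
  assumes "\<exists>haar. left_haar_system X haar"
    and "fell_bundle X A"
    and "lc_group H TH"
    and "fell_group_action X A H TH actX actA"
    and "free_action H (gtop X) actX"
    and "proper_action TH (gtop X) actX"
  shows "\<exists>\<rho> gact.
    groupoid_action (quotient_groupoid X H actX) (unit_space X) \<rho> gact \<and>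
    commuting_actions (quotient_groupoid X H actX) (unit_space X) \<rho> gact H actX \<and>
    (\<exists>\<phi> \<Phi>.
      fell_iso X A
        (trans_groupoid (quotient_groupoid X H actX) (unit_space X) \<rho> gact)
        (trans_fell (quotient_groupoid X H actX) (quotient_fell X A H actA) (unit_space X) \<rho> gact)
        \<phi> \<Phi> \<and>
      equivariant_on H (arrows X) actX (second_act actX) \<phi> \<and>
      equivariant_on H (total A) actA (second_act actX) \<Phi>)"
proof -
  interpret fell_group_action X A H TH actX actA by (rule assms)
  interpret free_proper_fell_action X A H TH actX actA
    by unfold_locales (use assms in auto)
  have "equivariant_on H (arrows X) actX (second_act actX) (\<lambda>x. (orbit H actX x, src X x))"
    by (simp add: equivariant_on_def second_act_def actX.orbit_act actX_hom)
  moreover have "equivariant_on H (total A) actA (second_act actX)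
      (\<lambda>a. (orbit H actA a, src X (proj A a)))"
    by (simp add: equivariant_on_def second_act_def actA.orbit_act actA_facts actX_hom proj_closed)
  ultimately show ?thesis
    using quotient_groupoid_action unit_act_commutes fell_iso_transformation by blast
qed

end
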